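(* Let $(X,\rho)$ be a partial metric space and let $\alpha,\beta$ be real numbers with $0<\alpha<\beta\le 1$. Then $S_\rho^\alpha(X)\subseteq S_\rho^\beta(X)$.
   Context: A partial metric on a non-empty set $X$ is a function $\rho:X\times X\to\mathbb{R}$ such that for all $x,y,z\in X$: (i) $0\le\rho(x,x)\le\rho(x,y)$; (ii) if $\rho(x,x)=\rho(x,y)=\rho(y,y)$ then $x=y$; (iii) $\rho(x,y)=\rho(y,x)$; (iv) $\rho(x,z)\le\rho(x,y)+\rho(y,z)-\rho(y,y)$. The pair $(X,\rho)$ is called a partial metric space. Here $\mathbb{N}=\{1,2,3,\dots\}$ and sequences are indexed by $\mathbb{N}$. For $\alpha\in(0,1]$, a sequence $(x_k)$ in $X$ is $\rho$-statistically convergent of order $\alpha$ to $x\in X$ if for every $\varepsilon>0$, $\lim_{n\to\infty}\frac{1}{n^\alpha}\left|\{k\le n:|\rho(x_k,x)-\rho(x,x)|\ge\varepsilon\}\right|=0$, where $|\cdot|$ of a set denotes its cardinality. $S_\rho^\alpha(X)$ is the set of all sequences in $X$ that are $\rho$-statistically convergent of order $\alpha$ to some $x\in X$. *)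

theory Defs
  imports Complex_Main "HOL-Library.FuncSet"
begin

locale partial_metric_space =
  fixes X :: "'a set" and \<rho> :: "'a \<Rightarrow> 'a \<Rightarrow> real"
  assumes nonempty: "X \<noteq> {}"
    and self_nonneg: "x \<in> X \<Longrightarrow> 0 \<le> \<rho> x x"
    and self_le: "x \<in> X \<Longrightarrow> y \<in> X \<Longrightarrow> \<rho> x x \<le> \<rho> x y"
    and eq_if: "x \<in> X \<Longrightarrow> y \<in> X \<Longrightarrow> \<rho> x x = \<rho> x y \<Longrightarrow> \<rho> x y = \<rho> y y \<Longrightarrow> x = y"
    and commute: "x \<in> X \<Longrightarrow> y \<in> X \<Longrightarrow> \<rho> x y = \<rho> y x"
    and triangle: "x \<in> X \<Longrightarrow> y \<in> X \<Longrightarrow> z \<in> X \<Longrightarrow> \<rho> x z \<le> \<rho> x y + \<rho> y z - \<rho> y y"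

text \<open>Sequences are indexed by the positive integers. A sequence in \<open>X\<close> is an element of
  \<open>{1..} \<rightarrow>\<^sub>E X\<close>; extensionality fixes the irrelevant value at index 0, so that sets of
  such functions are exactly sets of sequences. The order \<open>\<alpha>\<close> is meant to lie in \<open>(0, 1]\<close>.\<close>

definition stat_convergent_to ::
    "('a \<Rightarrow> 'a \<Rightarrow> real) \<Rightarrow> real \<Rightarrow> (nat \<Rightarrow> 'a) \<Rightarrow> 'a \<Rightarrow> bool" where
  "stat_convergent_to \<rho> \<alpha> s x \<longleftrightarrow>
    (\<forall>\<epsilon>>0. (\<lambda>n. 1 / real n powr \<alpha> *
        real (card {k \<in> {1..n}. \<bar>\<rho> (s k) x - \<rho> x x\<bar> \<ge> \<epsilon>})) \<longlonglongrightarrow> 0)"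

definition stat_convergent_seqs ::
    "'a set \<Rightarrow> ('a \<Rightarrow> 'a \<Rightarrow> real) \<Rightarrow> real \<Rightarrow> (nat \<Rightarrow> 'a) set" where
  "stat_convergent_seqs X \<rho> \<alpha> =
    {s \<in> {1..} \<rightarrow>\<^sub>E X. \<exists>x\<in>X. stat_convergent_to \<rho> \<alpha> s x}"

end

theory Submission
  imports Defs
begin

text \<open>The number of \<open>k \<le> n\<close> at which the sequence is \<open>\<epsilon>\<close>-far from its limit does not depend on
  the order; only the weight \<open>1 / n\<^sup>\<alpha>\<close> does. Since \<open>n \<ge> 1\<close>, raising the exponent shrinks this weight,
  so the densities of order \<open>\<beta>\<close> are squeezed between \<open>0\<close> and those of order \<open>\<alpha>\<close>. Hence a sequence
  keeps its limit when the order grows.\<close>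

lemma stat_convergent_to_mono:
  assumes conv: "stat_convergent_to \<rho> \<alpha> s x" and le: "\<alpha> \<le> \<beta>"
  shows "stat_convergent_to \<rho> \<beta> s x"
  unfolding stat_convergent_to_def
proof (intro allI impI)
  fix \<epsilon> :: real
  assume "\<epsilon> > 0"
  define c where "c n = real (card {k \<in> {1..n}. \<bar>\<rho> (s k) x - \<rho> x x\<bar> \<ge> \<epsilon>})" for n
  have lim: "(\<lambda>n. 1 / real n powr \<alpha> * c n) \<longlonglongrightarrow> 0"
    using conv \<open>\<epsilon> > 0\<close> unfolding stat_convergent_to_def c_def by simp
  have bound: "1 / real n powr \<beta> * c n \<le> 1 / real n powr \<alpha> * c n" if "n \<ge> 1" for n
  proof (rule mult_right_mono)
    show "1 / real n powr \<beta> \<le> 1 / real n powr \<alpha>"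
      using that le by (intro divide_left_mono powr_mono) auto
  qed (simp add: c_def)
  have "(\<lambda>n. 1 / real n powr \<beta> * c n) \<longlonglongrightarrow> 0"
  proof (rule tendsto_sandwich[OF _ _ tendsto_const lim])
    show "\<forall>\<^sub>F n in sequentially. 0 \<le> 1 / real n powr \<beta> * c n"
      by (simp add: c_def)
    show "\<forall>\<^sub>F n in sequentially. 1 / real n powr \<beta> * c n \<le> 1 / real n powr \<alpha> * c n"
      using bound by (rule eventually_sequentiallyI)
  qed
  then show "(\<lambda>n. 1 / real n powr \<beta> *
      real (card {k \<in> {1..n}. \<bar>\<rho> (s k) x - \<rho> x x\<bar> \<ge> \<epsilon>})) \<longlonglongrightarrow> 0"
    unfolding c_def .
qed

theorem theorem2p2:
  fixes X :: "'a set" and \<rho> :: "'a \<Rightarrow> 'a \<Rightarrow> real" and \<alpha> \<beta> :: real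
  assumes "partial_metric_space X \<rho>"
    and "0 < \<alpha>" and "\<alpha> < \<beta>" and "\<beta> \<le> 1"
  shows "stat_convergent_seqs X \<rho> \<alpha> \<subseteq> stat_convergent_seqs X \<rho> \<beta>"
proof
  fix s
  assume "s \<in> stat_convergent_seqs X \<rho> \<alpha>"
  then obtain x where "s \<in> {1..} \<rightarrow>\<^sub>E X" "x \<in> X" "stat_convergent_to \<rho> \<alpha> s x"
    unfolding stat_convergent_seqs_def by auto
  moreover from this(3) have "stat_convergent_to \<rho> \<beta> s x"
    using \<open>\<alpha> < \<beta>\<close> by (simp add: stat_convergent_to_mono)
  ultimately show "s \<in> stat_convergent_seqs X \<rho> \<beta>"
    unfolding stat_convergent_seqs_def by auto
qed

end
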